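(* For every integer $k\ge 2$, the Mirrored-Binomial graph $MB_k$ (on $2^k$ vertices) is a series-parallel graph.
   Context: A multigraph is series-parallel (SP) if it can be obtained from $K_2$ (a single edge between two vertices called the terminals $s$ and $t$) by a finite sequence of operations, each being either a series extension (replace an edge $\{x,y\}$ by a new vertex $z$ and edges $\{x,z\},\{z,y\}$) or a parallel extension (add a new edge parallel to an existing edge $\{x,y\}$); a simple graph is SP if it is the result of such a sequence containing no multiple edges at the end. The graphs $MB_k$, each with two distinguished vertices $s,t$, are defined recursively: $MB_2$ is the path $s-a-b-t$ on four vertices. For $k\ge 3$, take two disjoint copies $C_1, C_2$ of $MB_{k-1}$, with distinguished vertices $s_1,t_1$ in $C_1$ and $s_2,t_2$ in $C_2$, and add the two edges $\{s_1,s_2\}$ and $\{t_1,t_2\}$; in the resulting graph $MB_k$ set $s=s_2$, $t=t_1$ (and $s'=s_1$, $t'=t_2$). (Equivalently, $MB_k$ consists of two binomial trees of dimension $k-1$, rooted at $s$ and $t$, with each non-root leaf of one tree joined to the corresponding leaf of the mirrored other tree.) *)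

theory Defs
  imports Main "HOL-Library.Multiset"
begin

record 'a sgraph =
  verts :: "'a set"
  edges :: "'a set set"

record 'a st_graph = "'a sgraph" +
  src :: 'a
  snk :: 'a

text \<open>
  \<open>sp_multigraph s t V M\<close>: the multigraph with vertex set \<open>V\<close> and edge multiset \<open>M\<close> arises from
  the single edge between the terminals \<open>s\<close> and \<open>t\<close> by series and parallel extensions.
  An edge is the set of its two end vertices; parallel edges are counted by multiplicity in \<open>M\<close>.
  The edge \<open>{x, y}\<close> in the rules always has \<open>x \<noteq> y\<close>, by \<open>sp_multigraph_edge\<close> below.
\<close>

inductive sp_multigraph :: "'a \<Rightarrow> 'a \<Rightarrow> 'a set \<Rightarrow> 'a set multiset \<Rightarrow> bool" for s t where
  K2: "s \<noteq> t \<Longrightarrow> sp_multigraph s t {s, t} {#{s, t}#}"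
| series: "sp_multigraph s t V M \<Longrightarrow> {x, y} \<in># M \<Longrightarrow> z \<notin> V \<Longrightarrow>
    sp_multigraph s t (insert z V) (M - {#{x, y}#} + {#{x, z}, {z, y}#})"
| parallel: "sp_multigraph s t V M \<Longrightarrow> {x, y} \<in># M \<Longrightarrow>
    sp_multigraph s t V (add_mset {x, y} M)"

lemma sp_multigraph_edge:
  assumes "sp_multigraph s t V M" "e \<in># M"
  shows "e \<subseteq> V \<and> card e = 2"
  using assms
proof (induction arbitrary: e rule: sp_multigraph.induct)
  case (series V M x y z)
  have "{x, y} \<subseteq> V" using series.IH series.hyps by blast
  then have "x \<noteq> z" "y \<noteq> z" using series.hyps by auto
  moreover have "e \<in># M \<or> e = {x, z} \<or> e = {z, y}"
    using series.prems by (auto dest: in_diffD)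
  ultimately show ?case using series.IH \<open>{x, y} \<subseteq> V\<close> by fastforce
qed auto

text \<open>The last two conditions say that \<open>M\<close> has no multiple edges and is the edge set of \<open>G\<close>.\<close>

definition series_parallel :: "('a, 'b) sgraph_scheme \<Rightarrow> bool" where
  "series_parallel G \<longleftrightarrow>
     (\<exists>s t M. sp_multigraph s t (verts G) M \<and> (\<forall>e. count M e \<le> 1) \<and> set_mset M = edges G)"

text \<open>The path \<open>s - a - b - t\<close>; its vertices are the bit strings of length two.\<close>

definition path4 :: "bool list st_graph" where
  "path4 =
    (let s = [False, False]; a = [False, True]; b = [True, False]; t = [True, True]
     in \<lparr>verts = {s, a, b, t}, edges = {{s, a}, {a, b}, {b, t}}, src = s, snk = t\<rparr>)"

text \<open>
  The disjoint copies \<open>C\<^sub>1\<close> and \<open>C\<^sub>2\<close> of \<open>G\<close> are obtained by prefixing all vertices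
  with \<open>False\<close> and \<open>True\<close>, respectively.
\<close>

definition mirror_double :: "bool list st_graph \<Rightarrow> bool list st_graph" where
  "mirror_double G =
    (let s1 = False # src G; t1 = False # snk G; s2 = True # src G; t2 = True # snk G
     in \<lparr>verts = Cons False ` verts G \<union> Cons True ` verts G,
         edges = image (Cons False) ` edges G \<union> image (Cons True) ` edges G
                   \<union> {{s1, s2}, {t1, t2}},
         src = s2, snk = t1\<rparr>)"

text \<open>The values for \<open>k < 2\<close> are irrelevant.\<close>

fun MB :: "nat \<Rightarrow> bool list st_graph" where
  "MB (Suc (Suc (Suc n))) = mirror_double (MB (Suc (Suc n)))"
| "MB _ = path4"

end

theory Submission
  imports Defs
begin

text \<open>
  \<open>MB\<^sub>k\<close> is two-terminal series-parallel between its own vertices \<open>s\<close> and \<open>t\<close>, by induction on \<open>k\<close>: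
  it is the parallel composition of the edge \<open>{s\<^sub>2, s\<^sub>1}\<close> followed by \<open>C\<^sub>1\<close> and of \<open>C\<^sub>2\<close> followed by
  the edge \<open>{t\<^sub>2, t\<^sub>1}\<close>. So one builds the 4-cycle \<open>s\<^sub>2 - s\<^sub>1 - t\<^sub>1 - t\<^sub>2\<close> and substitutes the copies \<open>C\<^sub>1\<close> and
  \<open>C\<^sub>2\<close> for the edges \<open>{s\<^sub>1, t\<^sub>1}\<close> and \<open>{s\<^sub>2, t\<^sub>2}\<close>.
\<close>

lemma sp_multigraph_terminals:
  assumes "sp_multigraph s t V M"
  shows "s \<in> V" "t \<in> V" "s \<noteq> t"
  using assms by (induction rule: sp_multigraph.induct) auto

lemma sp_multigraph_map:
  assumes "sp_multigraph s t V M" "inj f"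
  shows "sp_multigraph (f s) (f t) (f ` V) (image_mset (image f) M)"
  using assms(1)
proof (induction rule: sp_multigraph.induct)
  case K2
  then show ?case
    using sp_multigraph.K2[of "f s" "f t"] assms(2) by (simp add: inj_eq)
next
  case (series V M x y z)
  have "{f x, f y} \<in># image_mset (image f) M"
    using imageI[OF series.hyps(2), of "image f"] by simp
  from sp_multigraph.series[OF series.IH this, of "f z"] show ?case
    using series.hyps assms(2) by (simp add: image_mset_Diff inj_image_mem_iff)
next
  case (parallel V M x y)
  have "{f x, f y} \<in># image_mset (image f) M"
    using imageI[OF parallel.hyps(2), of "image f"] by simp
  from sp_multigraph.parallel[OF parallel.IH this] show ?case by simp
qed

lemma sp_multigraph_series_add_mset:
  assumes "sp_multigraph s t V (add_mset {x, y} M)" "z \<notin> V"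
  shows "sp_multigraph s t (insert z V) (M + {#{x, z}, {z, y}#})"
  using sp_multigraph.series[OF assms(1) _ assms(2), of x y] by simp

text \<open>The extensions that build \<open>N\<close> from the edge \<open>{x, y}\<close> are
  replayed inside the larger multigraph, with its copy of \<open>{x, y}\<close> as the initial edge.
  The intersection condition keeps each new vertex of \<open>W\<close> fresh for \<open>V\<close>
  too.\<close>

lemma sp_multigraph_subst_edge:
  assumes "sp_multigraph x y W N" "sp_multigraph s t V (add_mset {x, y} M)" "V \<inter> W = {x, y}"
  shows "sp_multigraph s t (V \<union> W) (M + N)"
  using assms(1,3)
proof (induction rule: sp_multigraph.induct)
  case K2
  have "V \<union> {x, y} = V" using K2 by blast
  then show ?case using assms(2) by simp
next
  case (series W N u v z)
  have "x \<in> W" "y \<in> W" using sp_multigraph_terminals[OF series.hyps(1)] by simp_all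
  \<comment> \<open>As \<open>x\<close> and \<open>y\<close> already lie in \<open>W\<close>, the
    fresh \<open>z\<close> is neither of them, so the condition on
    \<open>V \<inter> insert z W\<close> keeps \<open>z\<close> out of \<open>V\<close>.\<close>
  then have "V \<inter> W = {x, y}" "z \<notin> V \<union> W" using series.prems series.hyps(3) by auto
  moreover have "{u, v} \<in># M + N" using series.hyps(2) by simp
  ultimately have "sp_multigraph s t (insert z (V \<union> W))
      (M + N - {#{u, v}#} + {#{u, z}, {z, v}#})"
    using series.IH by (intro sp_multigraph.series) auto
  then show ?case using series.hyps(2) by simp
next
  case (parallel W N u v)
  then show ?case
    using sp_multigraph.parallel[of s t "V \<union> W" "M + N" u v] by simp
qed

lemma sp_multigraph_mirror:
  assumes C1: "sp_multigraph s1 t1 V1 M1" and C2: "sp_multigraph s2 t2 V2 M2"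
    and disj: "V1 \<inter> V2 = {}"
  shows "sp_multigraph s2 t1 (V1 \<union> V2) (M1 + M2 + {#{s1, s2}, {t1, t2}#})"
proof -
  note in_V = sp_multigraph_terminals[OF C1] sp_multigraph_terminals[OF C2]
  have ne: "s2 \<noteq> t1" "s1 \<noteq> s2" "t2 \<noteq> t1" "s1 \<noteq> t2" using in_V disj by auto
  \<comment> \<open>Two parallel edges: subdividing one by \<open>s1\<close> and the other by
    \<open>t2\<close> yields the 4-cycle.\<close>
  have "sp_multigraph s2 t1 {s2, t1} {#{s2, t1}, {s2, t1}#}"
    using sp_multigraph.parallel[OF sp_multigraph.K2[OF ne(1)], of s2 t1] by simp
  from sp_multigraph_series_add_mset[OF this, of s1]
  have "sp_multigraph s2 t1 {s1, s2, t1} (add_mset {s2, t1} {#{s2, s1}, {s1, t1}#})"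
    using in_V ne by (simp add: add_mset_commute)
  from sp_multigraph_series_add_mset[OF this, of t2]
  have "sp_multigraph s2 t1 {t2, s1, s2, t1}
      (add_mset {s1, t1} {#{s2, t2}, {s2, s1}, {t2, t1}#})"
    using in_V ne by (simp add: add_mset_commute)
  from sp_multigraph_subst_edge[OF C1 this]
  have "sp_multigraph s2 t1 ({t2, s1, s2, t1} \<union> V1)
      (add_mset {s2, t2} ({#{s2, s1}, {t2, t1}#} + M1))"
    using in_V disj by auto
  from sp_multigraph_subst_edge[OF C2 this]
  have "sp_multigraph s2 t1 ({t2, s1, s2, t1} \<union> V1 \<union> V2) ({#{s2, s1}, {t2, t1}#} + M1 + M2)"
    using in_V disj by auto
  moreover have "{t2, s1, s2, t1} \<union> V1 \<union> V2 = V1 \<union> V2" using in_V by auto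
  ultimately show ?thesis by (simp add: insert_commute[of s1 s2] insert_commute[of t1 t2])
qed

text \<open>Finiteness matters because \<open>mset_set\<close> of an infinite set is the empty
  multiset.\<close>

lemma finite_edges_MB: "finite (edges (MB k))"
  by (induction k rule: MB.induct) (simp_all add: path4_def mirror_double_def Let_def)

lemma sp_multigraph_path4:
  "sp_multigraph (src path4) (snk path4) (verts path4) (mset_set (edges path4))"
proof -
  define s a b t where "s = [False, False]" and "a = [False, True]"
    and "b = [True, False]" and "t = [True, True]"
  note defs = s_def a_def b_def t_def
  have "sp_multigraph s t {s, t} {#{s, t}#}" by (rule sp_multigraph.K2) (simp add: defs)
  from sp_multigraph_series_add_mset[OF this, of a]
  have "sp_multigraph s t {a, s, t} (add_mset {a, t} {#{s, a}#})"
    by (simp add: defs add_mset_commute)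
  from sp_multigraph_series_add_mset[OF this, of b]
  have "sp_multigraph s t {b, a, s, t} {#{s, a}, {a, b}, {b, t}#}"
    by (simp add: defs add_mset_commute)
  moreover have "mset_set {{s, a}, {a, b}, {b, t}} = {#{s, a}, {a, b}, {b, t}#}"
    by (simp add: defs doubleton_eq_iff)
  moreover have "{b, a, s, t} = {s, a, b, t}" by auto
  ultimately show ?thesis by (simp add: path4_def Let_def flip: defs)
qed

text \<open>The composition yields a sum of edge multisets. It equals \<open>mset_set\<close> of the
  union because the two copies and the connecting edges share no edge, as the leading bits of the
  end vertices show.\<close>

lemma sp_multigraph_mirror_double:
  assumes sp: "sp_multigraph (src G) (snk G) (verts G) (mset_set (edges G))"
    and fin: "finite (edges G)"
  shows "sp_multigraph (src (mirror_double G)) (snk (mirror_double G))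
    (verts (mirror_double G)) (mset_set (edges (mirror_double G)))"
proof -
  let ?E = "\<lambda>b. image (Cons b) ` edges G"
  let ?S = "{{False # src G, True # src G}, {False # snk G, True # snk G}}"
  have copy: "sp_multigraph (b # src G) (b # snk G) (Cons b ` verts G) (mset_set (?E b))" for b
    using sp_multigraph_map[OF sp, of "Cons b"]
    by (simp add: image_mset_mset_set inj_on_image inj_on_def inj_image_eq_iff)
  have "sp_multigraph (True # src G) (False # snk G)
      (Cons False ` verts G \<union> Cons True ` verts G)
      (mset_set (?E False) + mset_set (?E True) +
        {#{False # src G, True # src G}, {False # snk G, True # snk G}#})"
    by (rule sp_multigraph_mirror[OF copy copy]) auto
  moreover have "mset_set (?E False \<union> ?E True \<union> ?S) =
      mset_set (?E False) + mset_set (?E True) +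
        {#{False # src G, True # src G}, {False # snk G, True # snk G}#}"
  proof -
    have hd: "hd v = b" if "f \<in> ?E b" "v \<in> f" for b f v
      using that by auto
    \<comment> \<open>The leading bit can only separate nonempty edges; here every edge has two
      ends.\<close>
    have ne: "f \<noteq> {}" if "f \<in> ?E b" for b f
      using sp_multigraph_edge[OF copy[of b], of f] that fin by auto
    have "?E False \<inter> ?E True = {}"
    proof (rule equals0I)
      fix f assume f: "f \<in> ?E False \<inter> ?E True"
      then obtain v where v: "v \<in> f" using ne[of f True] by blast
      have "hd v = False" by (rule hd[OF IntD1[OF f] v])
      moreover have "hd v = True" by (rule hd[OF IntD2[OF f] v])
      ultimately show False by simp
    qed
    \<comment> \<open>A connecting edge has ends with both leading bits, an edge of a copy only with
      one.\<close>
    moreover have "f \<notin> ?E b" if "f \<in> ?S" for b f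
    proof -
      have "\<exists>u. False # u \<in> f \<and> True # u \<in> f" using that by auto
      then obtain u where "False # u \<in> f" "True # u \<in> f" by metis
      then show ?thesis using hd[of f b "False # u"] hd[of f b "True # u"] by (metis list.sel(1))
    qed
    then have "(?E False \<union> ?E True) \<inter> ?S = {}" by blast
    \<comment> \<open>The two connecting edges differ because the terminals of \<open>G\<close>
      do.\<close>
    moreover have "mset_set ?S =
        {#{False # src G, True # src G}, {False # snk G, True # snk G}#}"
      using sp_multigraph_terminals[OF sp] by (simp add: doubleton_eq_iff)
    ultimately show ?thesis using fin
      by (subst mset_set_Union; simp add: mset_set_Union)
  qed
  ultimately show ?thesis by (simp add: mirror_double_def Let_def)
qed

lemma sp_multigraph_MB:
  "sp_multigraph (src (MB k)) (snk (MB k)) (verts (MB k)) (mset_set (edges (MB k)))"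
  by (induction k rule: MB.induct)
    (simp_all add: sp_multigraph_path4 sp_multigraph_mirror_double finite_edges_MB)

lemma card_verts_mirror_double:
  assumes "finite (verts G)"
  shows "card (verts (mirror_double G)) = 2 * card (verts G)"
proof -
  have "Cons False ` verts G \<inter> Cons True ` verts G = {}" by auto
  then show ?thesis
    using assms by (simp add: mirror_double_def Let_def card_Un_disjoint card_image)
qed

lemma finite_verts_MB: "finite (verts (MB k))"
  by (induction k rule: MB.induct) (simp_all add: path4_def mirror_double_def Let_def)

lemma card_verts_MB:
  assumes "k \<ge> 2"
  shows "card (verts (MB k)) = 2 ^ k"
  using assms
proof (induction k rule: MB.induct)
  case (1 n)
  then show ?case by (simp add: card_verts_mirror_double finite_verts_MB)
qed (simp_all add: path4_def Let_def)

theorem theorem1: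
  fixes k :: nat
  assumes "k \<ge> 2"
  shows "card (verts (MB k)) = 2 ^ k \<and> series_parallel (MB k)"
proof
  show "card (verts (MB k)) = 2 ^ k"
    by (rule card_verts_MB[OF assms])
  show "series_parallel (MB k)"
    unfolding series_parallel_def
    using sp_multigraph_MB[of k] finite_edges_MB[of k]
    \<comment> \<open>Multiplicities in \<open>mset_set\<close> never exceed one, so the absence of
      multiple edges is immediate for this witness.\<close>
    by (intro exI[of _ "src (MB k)"] exI[of _ "snk (MB k)"] exI[of _ "mset_set (edges (MB k))"])
      (simp add: count_mset_set')
qed

end
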